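(* Let $0<\beta\le1<\alpha\le2$ and, for $a>0$, let $\gamma:[0,2\pi]\to\mathbb{C}$ be given by $$\gamma(\theta)=1+2^{\alpha}\Bigl(\sin\tfrac{\theta}{2}\Bigr)^{\alpha}e^{\mathrm{i}\left[\frac{\alpha\pi}{2}+\theta\left(2-\frac{\alpha}{2}\right)\right]}+a\,2^{\beta}\Bigl(\sin\tfrac{\theta}{2}\Bigr)^{\beta}e^{\mathrm{i}\left[\frac{\beta\pi}{2}+\theta\left(1-\frac{\beta}{2}\right)\right]}.$$ Define $$a_1=2^{\alpha-\beta},\qquad a_2=2^{\alpha-\beta}\,\frac{4-\alpha}{2-\beta}.$$ Then: 1. $\gamma(0)=\gamma(\pi)$ if and only if $a=a_1$; 2. $\gamma'(\pi)=0$ if and only if $a=a_2$; 3. $0<a_1<a_2$. Thus $a_1$ is the unique value of $a$ for which $\gamma(0)=\gamma(\pi)$, and $a_2$ is the unique value of $a$ for which the curve $\gamma$ is stationary at $\theta=\pi$.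
   Context: Convention: $0^{\alpha}=0^{\beta}=0$. The prime denotes the derivative with respect to $\theta$. *)

theory Defs
  imports "HOL-Analysis.Analysis"
begin

(* The curve has parameter domain {0..2*pi}, where sin (t/2) \<ge> 0; its values outside that
   interval carry no meaning.  The convention 0^\<alpha> = 0^\<beta> = 0 is built into powr. *)
definition gamma_curve :: "real \<Rightarrow> real \<Rightarrow> real \<Rightarrow> real \<Rightarrow> complex" where
  "gamma_curve \<alpha> \<beta> a t =
     1 + complex_of_real (2 powr \<alpha> * sin (t / 2) powr \<alpha>)
           * exp (\<i> * complex_of_real (\<alpha> * pi / 2 + t * (2 - \<alpha> / 2)))
       + complex_of_real (a * 2 powr \<beta> * sin (t / 2) powr \<beta>)
           * exp (\<i> * complex_of_real (\<beta> * pi / 2 + t * (1 - \<beta> / 2)))"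

definition a1 :: "real \<Rightarrow> real \<Rightarrow> real" where
  "a1 \<alpha> \<beta> = 2 powr (\<alpha> - \<beta>)"

definition a2 :: "real \<Rightarrow> real \<Rightarrow> real" where
  "a2 \<alpha> \<beta> = 2 powr (\<alpha> - \<beta>) * ((4 - \<alpha>) / (2 - \<beta>))"

end

theory Submission
  imports Defs
begin

text \<open>Both non-constant terms have the form c sin(t/2)^p cis(p pi/2 + t(k - p/2)), with (p, k)
  = (\<alpha>, 2) and (\<beta>, 1). At t = pi the two p-parts of the phase cancel, leaving cis(k
  pi), which is 1 or -1, and sin(t/2) is at its maximum 1. So gamma(pi) = 1 + 2^\<alpha> - a
  2^\<beta> (\<open>gamma_curve_pi\<close>), while gamma(0) = 1, and gamma'(pi) is i times a real
  number affine in a (\<open>gamma_curve_has_vector_derivative_pi\<close>). Each condition is one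
  linear equation in a, with root \<open>a1\<close> or \<open>a2\<close>; their ratio is (4 -
  \<alpha>)/(2 - \<beta>) > 1.\<close>

lemma cis_phase_pi: "cis (p * pi / 2 + pi * (k - p / 2)) = cis (k * pi)"
  by (simp add: algebra_simps)

text \<open>Only the phase contributes, since the derivative of \<open>sin (t / 2)\<close> vanishes at \<open>pi\<close>.\<close>

lemma sin_powr_cis_has_vector_derivative_pi:
  fixes c p k :: real
  shows "((\<lambda>t. complex_of_real (c * sin (t / 2) powr p) * cis (p * pi / 2 + t * (k - p / 2)))
    has_vector_derivative \<i> * complex_of_real (c * (k - p / 2)) * cis (k * pi)) (at pi)"
proof -
  have modulus: "((\<lambda>t. complex_of_real (c * sin (t / 2) powr p)) has_vector_derivative 0) (at pi)"
  proof -
    have "((\<lambda>t. c * sin (t / 2) powr p) has_real_derivative 0) (at pi)"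
      \<comment> \<open>The base sin(pi/2) = 1 is positive, so \<open>powr\<close> is differentiable
        there for every real p; the factor cos(pi/2) makes the derivative 0.\<close>
      by (auto intro!: derivative_eq_intros)
    from has_vector_derivative_of_real[OF this]
    show ?thesis by simp
  qed
  have phase: "((\<lambda>t. cis (p * pi / 2 + t * (k - p / 2)))
      has_vector_derivative \<i> * complex_of_real (k - p / 2) * cis (k * pi)) (at pi)"
    \<comment> \<open>Expanding cis(k pi) back to the phase at pi gives the form that the chain rule
      produces.\<close>
    unfolding cis_phase_pi[of p k, symmetric] has_vector_derivative_def
    by (auto intro!: derivative_eq_intros simp: scaleR_conv_of_real algebra_simps)
  from has_vector_derivative_mult[OF modulus phase] show ?thesis
    by (simp add: algebra_simps)
qed

lemma gamma_curve_cis: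
  "gamma_curve \<alpha> \<beta> a t =
     1 + complex_of_real (2 powr \<alpha> * sin (t / 2) powr \<alpha>) * cis (\<alpha> * pi / 2 + t * (2 - \<alpha> / 2))
       + complex_of_real (a * 2 powr \<beta> * sin (t / 2) powr \<beta>) * cis (\<beta> * pi / 2 + t * (1 - \<beta> / 2))"
  by (simp add: gamma_curve_def cis_conv_exp)

lemma gamma_curve_0: "gamma_curve \<alpha> \<beta> a 0 = 1"
  by (simp add: gamma_curve_def)

lemma gamma_curve_pi:
  "gamma_curve \<alpha> \<beta> a pi = 1 + complex_of_real (2 powr \<alpha> - a * 2 powr \<beta>)"
  unfolding gamma_curve_cis cis_phase_pi by simp

text \<open>The derivative is purely imaginary, so being stationary at pi is a single real
  equation.\<close>

lemma gamma_curve_has_vector_derivative_pi: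
  "(gamma_curve \<alpha> \<beta> a has_vector_derivative
     \<i> * complex_of_real (2 powr \<alpha> * (2 - \<alpha> / 2) - a * 2 powr \<beta> * (1 - \<beta> / 2))) (at pi)"
proof -
  note \<alpha> = sin_powr_cis_has_vector_derivative_pi[of "2 powr \<alpha>" \<alpha> 2]
  note \<beta> = sin_powr_cis_has_vector_derivative_pi[of "a * 2 powr \<beta>" \<beta> 1]
  from has_vector_derivative_add[OF has_vector_derivative_add[OF has_vector_derivative_const[of 1] \<alpha>] \<beta>]
  show ?thesis
    unfolding gamma_curve_cis[abs_def] by (simp add: algebra_simps cis_2pi[unfolded mult.commute[of 2]])
qed

lemma gamma_curve_0_eq_pi_iff:
  "gamma_curve \<alpha> \<beta> a 0 = gamma_curve \<alpha> \<beta> a pi \<longleftrightarrow> a = a1 \<alpha> \<beta>"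
proof -
  have "gamma_curve \<alpha> \<beta> a 0 = gamma_curve \<alpha> \<beta> a pi \<longleftrightarrow> 2 powr \<alpha> - a * 2 powr \<beta> = 0"
    unfolding gamma_curve_0 gamma_curve_pi by (simp only: of_real_eq_0_iff add_cancel_right_right)
  also have "\<dots> \<longleftrightarrow> a = a1 \<alpha> \<beta>"
    by (auto simp: a1_def powr_diff field_simps)
  finally show ?thesis .
qed

lemma vector_derivative_gamma_curve_pi_eq_0_iff:
  assumes "\<beta> < 2"
  shows "vector_derivative (gamma_curve \<alpha> \<beta> a) (at pi) = 0 \<longleftrightarrow> a = a2 \<alpha> \<beta>"
proof -
  have "vector_derivative (gamma_curve \<alpha> \<beta> a) (at pi) = 0
      \<longleftrightarrow> 2 powr \<alpha> * (2 - \<alpha> / 2) - a * 2 powr \<beta> * (1 - \<beta> / 2) = 0"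
    unfolding vector_derivative_at[OF gamma_curve_has_vector_derivative_pi]
    by (simp only: mult_eq_0_iff of_real_eq_0_iff complex_i_not_zero simp_thms)
  also have "\<dots> \<longleftrightarrow> a * 2 powr \<beta> * (2 - \<beta>) = 2 powr \<alpha> * (4 - \<alpha>)"
    by (auto simp: algebra_simps)
  also have "\<dots> \<longleftrightarrow> a = a2 \<alpha> \<beta>"
    using assms by (simp add: a2_def powr_diff eq_divide_eq mult.assoc)
  finally show ?thesis .
qed

lemma a1_pos: "0 < a1 \<alpha> \<beta>"
  by (simp add: a1_def)

text \<open>After division by 2^(\<alpha> - \<beta>) the claim is 2 - \<beta> < 4 -
  \<alpha>.\<close>

lemma a1_less_a2:
  assumes "\<beta> < 2" "\<alpha> - \<beta> < 2"
  shows "a1 \<alpha> \<beta> < a2 \<alpha> \<beta>"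
  using assms by (simp add: a1_def a2_def less_divide_eq)

theorem theorem3p2:
  fixes \<alpha> \<beta> :: real
  assumes "0 < \<beta>" and "\<beta> \<le> 1" and "1 < \<alpha>" and "\<alpha> \<le> 2"
  shows "(\<forall>a>0. gamma_curve \<alpha> \<beta> a 0 = gamma_curve \<alpha> \<beta> a pi \<longleftrightarrow> a = a1 \<alpha> \<beta>)
    \<and> (\<forall>a>0. gamma_curve \<alpha> \<beta> a differentiable at pi
          \<and> (vector_derivative (gamma_curve \<alpha> \<beta> a) (at pi) = 0 \<longleftrightarrow> a = a2 \<alpha> \<beta>))
    \<and> 0 < a1 \<alpha> \<beta> \<and> a1 \<alpha> \<beta> < a2 \<alpha> \<beta>
    \<and> {a. 0 < a \<and> gamma_curve \<alpha> \<beta> a 0 = gamma_curve \<alpha> \<beta> a pi} = {a1 \<alpha> \<beta>}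
    \<and> {a. 0 < a \<and> gamma_curve \<alpha> \<beta> a differentiable at pi
          \<and> vector_derivative (gamma_curve \<alpha> \<beta> a) (at pi) = 0} = {a2 \<alpha> \<beta>}"
proof -
  have "a1 \<alpha> \<beta> < a2 \<alpha> \<beta>"
    using assms by (intro a1_less_a2) auto
  \<comment> \<open>\<open>vector_derivative\<close> is a choice term, informative only where a
    derivative exists.\<close>
  moreover have "gamma_curve \<alpha> \<beta> a differentiable at pi" for a
    using gamma_curve_has_vector_derivative_pi by (rule differentiableI_vector)
  moreover have "vector_derivative (gamma_curve \<alpha> \<beta> a) (at pi) = 0 \<longleftrightarrow> a = a2 \<alpha> \<beta>" for a
    using assms by (intro vector_derivative_gamma_curve_pi_eq_0_iff) auto
  ultimately show ?thesis
    \<comment> \<open>Together with \<open>a1\<close> < \<open>a2\<close>, this also gives 0 <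
      \<open>a2\<close>, so both roots lie in the range a > 0 of the solution sets.\<close>
    using a1_pos[of \<alpha> \<beta>] by (auto simp: gamma_curve_0_eq_pi_iff)
qed

end
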